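(* Let $d\ge 1$ and let $t\mapsto \mathcal P(t)=(P_1(t),\dots,P_n(t))$, $t\in[-1,1]$, be a flip in $\mathbf R^d$ with flipset $\mathcal F(t)\subset\mathcal P(t)$ (of $d+1$ points), relating the generic configurations $\mathcal P(-1)$ and $\mathcal P(+1)$. Let $\sim$ denote the Orchard relation on $\mathcal P(-1)$, respectively on $\mathcal P(+1)$. (i) If two distinct points $P(t),Q(t)$ of $\mathcal P(t)$ (i.e. $P=P_i$, $Q=P_j$ with $i\ne j$) are either both contained in $\mathcal F(t)$ or both contained in its complement $\mathcal P(t)\setminus\mathcal F(t)$, then $$P(-1)\sim Q(-1)\ \text{ if and only if }\ P(+1)\sim Q(+1).$$ (ii) If $P(t)\in\mathcal F(t)$ and $Q(t)\notin\mathcal F(t)$, then $$P(-1)\sim Q(-1)\ \text{ if and only if }\ P(+1)\not\sim Q(+1).$$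
   Context: A set of $n$ distinct points in $\mathbf R^d$ is a generic configuration if every subset of at most $d+1$ of its points is affinely independent. For distinct points $P,Q$ of a generic configuration $\mathcal P$ of $n$ points, $n(P,Q)$ is the number of distinct affine hyperplanes spanned by $d$ distinct elements of $\mathcal P\setminus\{P,Q\}$ which separate $P$ and $Q$ (i.e. $P,Q$ lie in different connected components of the complement of the hyperplane). The Orchard relation on $\mathcal P$ is the equivalence relation: $P\sim Q$ if $P=Q$ or $n(P,Q)\equiv\binom{n-3}{d-1}\pmod 2$, where $\binom{m}{k}=m(m-1)\cdots(m-k+1)/k!$. A flip is a continuous path $t\mapsto\mathcal P(t)=(P_1(t),\dots,P_n(t))\in(\mathbf R^d)^n$, $t\in[-1,1]$, such that $\{P_1(t),\dots,P_n(t)\}$ is a generic configuration of $n$ points for every $t\neq 0$, while for $t=0$ there is exactly one set of $d+1$ indices $\{i_0,\dots,i_d\}$ such that $P_{i_0}(0),\dots,P_{i_d}(0)$ are affinely dependent; moreover any $d$ of the points $P_{i_0}(0),\dots,P_{i_d}(0)$ affinely span one and the same affine hyperplane, which contains all of them, and the simplices $(P_{i_0}(-1),\dots,P_{i_d}(-1))$ and $(P_{i_0}(1),\dots,P_{i_d}(1))$ carry opposite orientations (i.e. the determinants of the $d\times d$ matrices with rows $P_{i_1}-P_{i_0},\dots,P_{i_d}-P_{i_0}$ at $t=-1$ and $t=1$ have opposite signs). The flipset is $\mathcal F(t)=\{P_{i_0}(t),\dots,P_{i_d}(t)\}$; membership in $\mathcal F(t)$ is understood in terms of indices. *)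

theory Defs
  imports "HOL-Analysis.Analysis" "HOL-Number_Theory.Cong"
begin

text \<open>
  \<open>R\<^sup>d\<close> is \<^typ>\<open>real ^ 'd\<close> with \<open>d = CARD('d)\<close>, and a point of \<open>(R\<^sup>d)\<^sup>n\<close> is an element of
  \<^typ>\<open>(real ^ 'd) ^ 'n\<close> with \<open>n = CARD('n)\<close>.
\<close>

definition generic_configuration :: "nat \<Rightarrow> (real ^ 'd) set \<Rightarrow> bool" where
  "generic_configuration n \<P> \<longleftrightarrow> finite \<P> \<and> card \<P> = n \<and>
     (\<forall>S\<subseteq>\<P>. card S \<le> CARD('d) + 1 \<longrightarrow> \<not> affine_dependent S)"

definition affine_hyperplane :: "(real ^ 'd) set \<Rightarrow> bool" where
  "affine_hyperplane H \<longleftrightarrow> affine H \<and> aff_dim H = int CARD('d) - 1"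

definition separates :: "'a::topological_space set \<Rightarrow> 'a \<Rightarrow> 'a \<Rightarrow> bool" where
  "separates H P Q \<longleftrightarrow> P \<notin> H \<and> Q \<notin> H \<and> \<not> connected_component (- H) P Q"

definition separating_hyperplanes ::
    "(real ^ 'd) set \<Rightarrow> real ^ 'd \<Rightarrow> real ^ 'd \<Rightarrow> (real ^ 'd) set set" where
  "separating_hyperplanes \<P> P Q =
     {H. affine_hyperplane H \<and>
         (\<exists>S. S \<subseteq> \<P> - {P, Q} \<and> card S = CARD('d) \<and> affine hull S = H) \<and>
         separates H P Q}"

text \<open>
  The upper entry \<open>n - 3\<close> may be negative (\<open>n = 2\<close>, \<open>d = 1\<close>), so the binomial coefficient is
  formed over the integers; \<open>gchoose\<close> is not available there (it is restricted to fields).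
  The division is exact.
\<close>

definition int_binomial :: "int \<Rightarrow> nat \<Rightarrow> int" where
  "int_binomial m k = (\<Prod>i<k. m - int i) div fact k"

definition orchard :: "(real ^ 'd) set \<Rightarrow> ((real ^ 'd) \<times> (real ^ 'd)) set" where
  "orchard \<P> =
     {(P, Q). P \<in> \<P> \<and> Q \<in> \<P> \<and>
        (P = Q \<or>
         [int (card (separating_hyperplanes \<P> P Q)) =
            int_binomial (int (card \<P>) - 3) (CARD('d) - 1)] (mod 2))}"

text \<open>
  Affine dependence of an indexed family: unlike \<^const>\<open>affine_dependent\<close> of its image, it
  counts repeated points. This matters for \<open>d = 1\<close>, where a flip makes two points coincide.
\<close>

definition affine_dependent_family :: "('i \<Rightarrow> 'a::real_vector) \<Rightarrow> 'i set \<Rightarrow> bool" where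
  "affine_dependent_family p I \<longleftrightarrow> \<not> inj_on p I \<or> affine_dependent (p ` I)"

definition configuration :: "(real ^ 'd) ^ 'n \<Rightarrow> (real ^ 'd) set" where
  "configuration p = range (\<lambda>i. p $ i)"

definition simplex_det :: "(real ^ 'd) ^ 'n \<Rightarrow> 'n \<Rightarrow> ('d \<Rightarrow> 'n) \<Rightarrow> real" where
  "simplex_det p i\<^sub>0 \<sigma> = det (\<chi> k. p $ \<sigma> k - p $ i\<^sub>0)"

text \<open>
  Two simplices on the index set \<open>F\<close>. The condition does not depend on the enumeration
  \<open>i\<^sub>0, \<sigma>\<close> of \<open>F\<close>, since changing it multiplies both determinants by the same sign.
\<close>

definition opposite_orientations ::
    "(real ^ 'd) ^ 'n \<Rightarrow> (real ^ 'd) ^ 'n \<Rightarrow> 'n set \<Rightarrow> bool" where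
  "opposite_orientations p q F \<longleftrightarrow>
     (\<exists>i\<^sub>0 \<sigma>. i\<^sub>0 \<in> F \<and> bij_betw \<sigma> UNIV (F - {i\<^sub>0}) \<and>
        simplex_det p i\<^sub>0 \<sigma> * simplex_det q i\<^sub>0 \<sigma> < 0)"

text \<open>\<open>flip P F\<close>: the path \<open>P\<close> is a flip, and \<open>F\<close> is the index set of its flipset.\<close>

definition flip :: "(real \<Rightarrow> (real ^ 'd) ^ 'n) \<Rightarrow> 'n set \<Rightarrow> bool" where
  "flip P F \<longleftrightarrow>
     continuous_on {-1..1} P \<and>
     (\<forall>t\<in>{-1..1}. t \<noteq> 0 \<longrightarrow> generic_configuration CARD('n) (configuration (P t))) \<and>
     card F = CARD('d) + 1 \<and>
     (\<forall>I. card I = CARD('d) + 1 \<longrightarrow>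
        (affine_dependent_family (\<lambda>i. P 0 $ i) I \<longleftrightarrow> I = F)) \<and>
     (\<exists>H. affine_hyperplane H \<and> (\<forall>i\<in>F. P 0 $ i \<in> H) \<and>
        (\<forall>J\<subseteq>F. card J = CARD('d) \<longrightarrow> affine hull ((\<lambda>i. P 0 $ i) ` J) = H)) \<and>
     opposite_orientations (P (-1)) (P 1) F"

end

theory Submission imports Defs begin

text \<open>
  Write \<open>D\<^sub>J(x)\<close> for the determinant with rows \<open>P\<^sub>k - x\<close>, where \<open>k\<close> runs through a set \<open>J\<close> of \<open>d\<close>
  indices. As a function of \<open>x\<close> it is affine, and if the points with index in \<open>J\<close> are affinely
  independent, its zero set is the hyperplane that they span (\<open>det_differences_affine\<close>,
  \<open>mem_affine_hull_iff_det\<close>). Hence this hyperplane separates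
  \<open>P\<^sub>i\<close> from \<open>P\<^sub>j\<close> iff \<open>D\<^sub>J(P\<^sub>i)\<close> and \<open>D\<^sub>J(P\<^sub>j)\<close> have opposite signs (\<open>separates_affine_hull_iff_det\<close>). In a
  generic configuration distinct index sets span distinct hyperplanes, so \<open>n(P\<^sub>i, P\<^sub>j)\<close> is the
  number of \<open>d\<close>-element index sets \<open>J\<close> avoiding \<open>i\<close> and \<open>j\<close> for which these signs are opposite
  (\<open>card_separating_hyperplanes\<close>).

  Along a flip, \<open>D\<^sub>J(P\<^sub>i)\<close> is continuous in time and never vanishes if \<open>J \<union> {i} \<noteq> F\<close>, so it keeps its sign;
  if \<open>J \<union> {i} = F\<close> it changes sign, because the simplex with index set \<open>F\<close> reverses its orientation
  (\<open>flip_simplex_det_sign\<close>). Therefore \<open>J\<close> changes from separating to non-separating, or back, iff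
  exactly one of \<open>J \<union> {i}\<close> and \<open>J \<union> {j}\<close> equals \<open>F\<close> (\<open>flip_separating_index_sets\<close>). Since \<open>J\<close> avoids
  \<open>i\<close> and \<open>j\<close>, this never happens if \<open>i\<close> and \<open>j\<close> are both in \<open>F\<close> or both outside. If \<open>i \<in> F\<close> and \<open>j \<notin> F\<close>, it
  happens for the single set \<open>J = F - {i}\<close>, so that \<open>n(P\<^sub>i, P\<^sub>j)\<close> changes by one, while the parity with
  which it is compared does not depend on time.
\<close>

section \<open>The determinant of a simplex\<close>

lemma det_nonzero_iff_independent_rows:
  fixes A :: "real ^ 'd ^ 'd"
  shows "det A \<noteq> 0 \<longleftrightarrow> independent (rows A) \<and> card (rows A) = CARD('d)"
proof -
  have fin: "finite (rows A)" and le: "card (rows A) \<le> CARD('d)"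
    using card_image_le[of UNIV "\<lambda>i. row i A"]
    by (auto simp: rows_def full_SetCompr_eq)
  have dl: "dim (rows A) \<le> card (rows A)" using fin by (simp add: dim_le_card span_superset)
  have "det A \<noteq> 0 \<longleftrightarrow> dim (rows A) \<ge> CARD('d)"
    by (simp add: det_eq_0_rank row_rank_def not_less)
  also have "\<dots> \<longleftrightarrow> independent (rows A) \<and> card (rows A) = CARD('d)"
    using le dl card_le_dim_spanning[OF subset_refl span_superset fin] dim_eq_card_independent[of "rows A"]
    by auto
  finally show ?thesis .
qed

lemma det_differences_nonzero_iff:
  fixes v :: "'d \<Rightarrow> real ^ 'd"
  shows "det (\<chi> k. v k - x) \<noteq> 0 \<longleftrightarrow>
           inj v \<and> x \<notin> range v \<and> \<not> affine_dependent (insert x (range v))"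
proof -
  have row: "row k (\<chi> k. v k - x) = v k - x" for k
    by (simp add: row_def vec_eq_iff)
  have rows: "rows (\<chi> k. v k - x) = (\<lambda>y. - x + y) ` range v"
    by (auto simp: rows_def row image_iff)
  have card: "card ((\<lambda>y. - x + y) ` range v) = CARD('d) \<longleftrightarrow> inj v"
    by (subst card_image) (auto simp: inj_on_def card_image dest: eq_card_imp_inj_on[rotated])
  have "x \<notin> range v" if "det (\<chi> k. v k - x) \<noteq> 0"
    using that det_zero_row(1)[of _ "\<chi> k. v k - x"] by (auto simp: row)
  then show ?thesis
    using det_nonzero_iff_independent_rows[of "\<chi> k. v k - x"] affine_dependent_iff_dependent[of x "range v"]
    unfolding rows card by blast
qed

lemma mem_affine_hull_iff_det:
  fixes v :: "'d \<Rightarrow> real ^ 'd"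
  assumes "inj v" and "\<not> affine_dependent (range v)"
  shows "x \<in> affine hull (range v) \<longleftrightarrow> det (\<chi> k. v k - x) = 0"
proof (cases "x \<in> range v")
  case True
  then show ?thesis
    using det_differences_nonzero_iff[of v x] by (simp add: hull_inc)
next
  case False
  have "affine_dependent (insert x (range v))" if "x \<in> affine hull (range v)"
    using that False by (auto simp: affine_dependent_def)
  moreover have "\<not> affine_dependent (insert x (range v))" if "x \<notin> affine hull (range v)"
    using that assms(2) False affine_independent_insert by blast
  ultimately show ?thesis
    using det_differences_nonzero_iff[of v x] False assms by blast
qed

text \<open>
  If \<open>i, \<sigma>\<close> enumerates the vertices of a simplex and \<open>j, \<tau>\<close> lists some of them, the two determinants
  differ by a factor that does not depend on the position of the vertices: the rows of one matrix
  are combinations of the rows of the other with constant coefficients.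
\<close>

lemma det_change_of_base_vertex:
  fixes \<sigma> \<tau> :: "'d::finite \<Rightarrow> 'i"
  assumes "inj \<sigma>" and "i \<notin> range \<sigma>" and "insert j (range \<tau>) \<subseteq> insert i (range \<sigma>)"
  obtains c :: real
    where "\<And>f :: 'i \<Rightarrow> real ^ 'd. det (\<chi> k. f (\<tau> k) - f j) = c * det (\<chi> k. f (\<sigma> k) - f i)"
proof
  define M :: "real ^ 'd ^ 'd" where
    "M = (\<chi> k m. of_bool (\<tau> k = \<sigma> m) - of_bool (j = \<sigma> m))"
  fix f :: "'i \<Rightarrow> real ^ 'd"
  have coord: "(\<Sum>m\<in>UNIV. of_bool (a = \<sigma> m) * (f (\<sigma> m) $ l - f i $ l)) = f a $ l - f i $ l"
    if a: "a \<in> insert i (range \<sigma>)" for a l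
  proof (cases "a = i")
    case True
    then show ?thesis using assms(2) by (auto intro!: sum.neutral)
  next
    case False
    with a obtain m0 where m0: "a = \<sigma> m0" by auto
    have "(\<Sum>m\<in>UNIV. of_bool (a = \<sigma> m) * (f (\<sigma> m) $ l - f i $ l)) =
          (\<Sum>m\<in>UNIV. if m = m0 then f a $ l - f i $ l else 0)"
      using assms(1) m0 by (intro sum.cong) (auto dest: injD)
    then show ?thesis by simp
  qed
  have "(\<chi> k. f (\<tau> k) - f j) = M ** (\<chi> k. f (\<sigma> k) - f i)"
  proof -
    have "(\<chi> k. f (\<tau> k) - f j) $ k $ l = (M ** (\<chi> k. f (\<sigma> k) - f i)) $ k $ l" for k l
    proof -
      have "(M ** (\<chi> k. f (\<sigma> k) - f i)) $ k $ l =
          (\<Sum>m\<in>UNIV. of_bool (\<tau> k = \<sigma> m) * (f (\<sigma> m) $ l - f i $ l)) -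
          (\<Sum>m\<in>UNIV. of_bool (j = \<sigma> m) * (f (\<sigma> m) $ l - f i $ l))"
        unfolding matrix_matrix_mult_def M_def
        by (simp only: vec_lambda_beta vector_minus_component left_diff_distrib sum_subtractf)
      also have "\<dots> = (\<chi> k. f (\<tau> k) - f j) $ k $ l"
        using assms(3) by (subst (1 2) coord) auto
      finally show ?thesis by simp
    qed
    then show ?thesis by (simp add: vec_eq_iff)
  qed
  then show "det (\<chi> k. f (\<tau> k) - f j) = det M * det (\<chi> k. f (\<sigma> k) - f i)"
    by (simp add: det_mul)
qed

text \<open>
  The determinant is affine in \<open>x\<close>, although \<open>x\<close> occurs in every row: based at another vertex, the
  same simplex has \<open>x\<close> in a single row.
\<close>

lemma det_differences_affine:
  fixes v :: "'d \<Rightarrow> real ^ 'd"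
  shows "det (\<chi> k. v k - ((1 - u) *\<^sub>R x + u *\<^sub>R y)) =
           (1 - u) * det (\<chi> k. v k - x) + u * det (\<chi> k. v k - y)"
proof -
  fix k0 :: 'd
  \<comment> \<open>The index \<open>None\<close> stands for the vertex \<open>x\<close>, and \<open>Some k\<close> for \<open>v k\<close>.\<close>
  obtain c where c: "\<And>f :: 'd option \<Rightarrow> real ^ 'd.
      det (\<chi> k. f (Some k) - f None) =
      c * det (\<chi> k. f (if k = k0 then None else Some k) - f (Some k0))"
    by (rule det_change_of_base_vertex[of "\<lambda>k. if k = k0 then None else Some k" "Some k0" None Some])
       (auto simp: inj_def image_iff split: option.splits if_splits)
  have based: "det (\<chi> k. v k - z) = c * det (\<chi> k. if k = k0 then z - v k0 else v k - v k0)" for z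
  proof -
    have "(\<chi> k. case_option z v (if k = k0 then None else Some k) - v k0) =
          (\<chi> k. if k = k0 then z - v k0 else v k - v k0)"
      by (simp add: vec_eq_iff)
    then show ?thesis
      using c[of "case_option z v"] by simp
  qed
  have split: "(1 - u) *\<^sub>R x + u *\<^sub>R y - v k0 = (1 - u) *s (x - v k0) + u *s (y - v k0)"
    by (simp add: vec_eq_iff algebra_simps)
  show ?thesis
    unfolding based split det_row_add det_row_mul by (simp add: algebra_simps)
qed

section \<open>Separation by a hyperplane\<close>

lemma continuous_on_same_sign:
  fixes f :: "'a :: topological_space \<Rightarrow> real"
  assumes "connected S" "continuous_on S f" "\<And>z. z \<in> S \<Longrightarrow> f z \<noteq> 0" "x \<in> S" "y \<in> S"
  shows "f x * f y > 0"
proof (rule ccontr)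
  assume "\<not> f x * f y > 0"
  then have "f x \<le> 0 \<and> 0 \<le> f y \<or> f y \<le> 0 \<and> 0 \<le> f x"
    by (auto simp: not_less mult_le_0_iff)
  moreover have "connected (f ` S)" using assms by (intro connected_continuous_image)
  ultimately have "0 \<in> f ` S" using assms(4,5) connected_contains_Icc[of "f ` S" "f x" "f y"] connected_contains_Icc[of "f ` S" "f y" "f x"] by (auto simp: subset_iff)
  with assms(3) show False by auto
qed

lemma separates_affine_hull_iff_det:
  fixes v :: "'d \<Rightarrow> real ^ 'd"
  assumes "inj v" and "\<not> affine_dependent (range v)"
  shows "separates (affine hull (range v)) x y \<longleftrightarrow>
           det (\<chi> k. v k - x) * det (\<chi> k. v k - y) < 0"
proof -
  define g where "g z = det (\<chi> k. v k - z)" for z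
  have H: "z \<in> affine hull (range v) \<longleftrightarrow> g z = 0" for z
    unfolding g_def using assms by (rule mem_affine_hull_iff_det)
  have cont: "continuous_on T g" for T
    unfolding g_def det_def by (auto intro!: continuous_intros)
  have "\<not> connected_component (- (affine hull range v)) x y" if "g x * g y < 0"
  proof
    assume "connected_component (- (affine hull range v)) x y"
    then obtain T where T: "connected T" "T \<subseteq> - (affine hull range v)" "x \<in> T" "y \<in> T"
      unfolding connected_component_def by auto
    have "g z \<noteq> 0" if "z \<in> T" for z
      using subsetD[OF T(2) that] H[of z] by simp
    then have "g x * g y > 0"
      using T(3,4) by (rule continuous_on_same_sign[OF T(1) cont])
    with that show False by simp
  qed
  moreover have "connected_component (- (affine hull range v)) x y" if pos: "g x * g y > 0"
  proof -
    have "g z \<noteq> 0" if z: "z \<in> closed_segment x y" for z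
    proof -
      obtain u where u: "0 \<le> u" "u \<le> 1" and z_eq: "z = (1 - u) *\<^sub>R x + u *\<^sub>R y"
        using z by (auto simp: closed_segment_def)
      have gz: "g z = (1 - u) * g x + u * g y"
        unfolding g_def z_eq by (rule det_differences_affine)
      \<comment> \<open>Along the segment \<open>g\<close> interpolates between two values of the same sign.\<close>
      have "g x * g z = (1 - u) * (g x)\<^sup>2 + u * (g x * g y)"
        by (simp add: gz algebra_simps power2_eq_square)
      also have "\<dots> > 0"
      proof (cases "u = 0")
        case True
        then show ?thesis using pos by auto
      next
        case False
        then show ?thesis using pos u by (intro add_nonneg_pos) auto
      qed
      finally show ?thesis by auto
    qed
    then show ?thesis
      unfolding connected_component_def by (intro exI[of _ "closed_segment x y"]) (auto simp: H)
  qed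
  ultimately show ?thesis
    unfolding separates_def H g_def[symmetric]
    by (metis linorder_neqE_linordered_idom mult_eq_0_iff less_irrefl)
qed

section \<open>Generic configurations and separating index sets\<close>

lemma generic_configuration_inj:
  fixes p :: "(real ^ 'd) ^ 'n"
  assumes "generic_configuration CARD('n) (configuration p)"
  shows "inj (\<lambda>i. p $ i)"
  using assms unfolding generic_configuration_def configuration_def
  by (auto intro: eq_card_imp_inj_on)

lemma generic_configuration_independent:
  fixes p :: "(real ^ 'd) ^ 'n"
  assumes "generic_configuration CARD('n) (configuration p)" and "card J \<le> CARD('d) + 1"
  shows "\<not> affine_dependent ((\<lambda>i. p $ i) ` J)"
proof -
  have "card ((\<lambda>i. p $ i) ` J) \<le> CARD('d) + 1"
    using assms(2) card_image_le[of J "\<lambda>i. p $ i"] by simp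
  moreover have "(\<lambda>i. p $ i) ` J \<subseteq> configuration p"
    by (auto simp: configuration_def)
  ultimately show ?thesis
    using assms(1) by (simp add: generic_configuration_def)
qed

lemma simplex_det_nonzero_iff:
  fixes p :: "(real ^ 'd) ^ 'n" and \<sigma> :: "'d \<Rightarrow> 'n"
  assumes "inj \<sigma>" and "i \<notin> range \<sigma>"
  shows "simplex_det p i \<sigma> \<noteq> 0 \<longleftrightarrow> \<not> affine_dependent_family (\<lambda>i. p $ i) (insert i (range \<sigma>))"
proof -
  have "inj_on (\<lambda>i. p $ i) (insert i (range \<sigma>)) \<longleftrightarrow>
        inj (\<lambda>k. p $ \<sigma> k) \<and> p $ i \<notin> range (\<lambda>k. p $ \<sigma> k)"
    using assms by (auto simp: inj_on_def rangeI) (metis rangeI)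
  then show ?thesis
    unfolding simplex_det_def det_differences_nonzero_iff affine_dependent_family_def
    by (simp add: image_image)
qed

lemma generic_configuration_simplex_det:
  fixes p :: "(real ^ 'd) ^ 'n" and \<sigma> :: "'d \<Rightarrow> 'n"
  assumes "generic_configuration CARD('n) (configuration p)" and "inj \<sigma>" and "i \<notin> range \<sigma>"
  shows "simplex_det p i \<sigma> \<noteq> 0"
proof -
  have "card (insert i (range \<sigma>)) \<le> CARD('d) + 1"
    using assms(2,3) by (simp add: card_image)
  then show ?thesis
    using generic_configuration_inj[OF assms(1)] generic_configuration_independent[OF assms(1)]
    unfolding simplex_det_nonzero_iff[OF assms(2,3)] affine_dependent_family_def
    by (meson inj_on_subset subset_UNIV)
qed

text \<open>
  The sets of \<open>d\<close> indices, avoiding \<open>i\<close> and \<open>j\<close>, whose points span a hyperplane separating the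
  points with indices \<open>i\<close> and \<open>j\<close>.
\<close>

definition separating_index_sets :: "(real ^ 'd) ^ 'n \<Rightarrow> 'n \<Rightarrow> 'n \<Rightarrow> 'n set set" where
  "separating_index_sets p i j =
     {J. i \<notin> J \<and> j \<notin> J \<and> card J = CARD('d) \<and>
         separates (affine hull ((\<lambda>k. p $ k) ` J)) (p $ i) (p $ j)}"

lemma card_separating_hyperplanes:
  fixes p :: "(real ^ 'd) ^ 'n"
  assumes gen: "generic_configuration CARD('n) (configuration p)"
  shows "card (separating_hyperplanes (configuration p) (p $ i) (p $ j)) =
           card (separating_index_sets p i j)"
proof -
  let ?h = "\<lambda>J. affine hull ((\<lambda>k. p $ k) ` J)"
  have inj: "inj (\<lambda>k. p $ k)" using gen by (rule generic_configuration_inj)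
  have sub: "J' \<subseteq> J" if J: "card J = CARD('d)" and J': "card J' = CARD('d)" and eq: "?h J = ?h J'" for J J'
  proof
    fix k assume "k \<in> J'"
    show "k \<in> J"
    proof (rule ccontr)
      assume "k \<notin> J"
      then have "p $ k \<notin> (\<lambda>k. p $ k) ` J" using inj by (auto dest: injD)
      moreover have "p $ k \<in> ?h J" using \<open>k \<in> J'\<close> unfolding eq by (simp add: hull_inc)
      ultimately have "affine_dependent ((\<lambda>k. p $ k) ` insert k J)"
        by (auto simp: affine_dependent_def)
      moreover have "card (insert k J) \<le> CARD('d) + 1"
        using J \<open>k \<notin> J\<close> by simp
      ultimately show False using generic_configuration_independent[OF gen] by blast
    qed
  qed
  have "inj_on ?h (separating_index_sets p i j)"
    using sub by (intro inj_onI) (auto 4 3 simp: separating_index_sets_def)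
  moreover have "?h ` separating_index_sets p i j =
                 separating_hyperplanes (configuration p) (p $ i) (p $ j)"
  proof (intro equalityI subsetI)
    fix H assume "H \<in> ?h ` separating_index_sets p i j"
    then obtain J where H: "H = ?h J" and J: "J \<in> separating_index_sets p i j" by auto
    let ?S = "(\<lambda>k. p $ k) ` J"
    have "card ?S = CARD('d)"
      using J inj by (simp add: separating_index_sets_def card_image inj_on_subset)
    moreover have "?S \<subseteq> configuration p - {p $ i, p $ j}"
      using J inj by (auto simp: separating_index_sets_def configuration_def dest: injD)
    moreover have "\<not> affine_dependent ?S"
      using J by (intro generic_configuration_independent[OF gen]) (simp add: separating_index_sets_def)
    ultimately show "H \<in> separating_hyperplanes (configuration p) (p $ i) (p $ j)"
      using J aff_dim_affine_independent[of ?S]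
      unfolding separating_hyperplanes_def affine_hyperplane_def H
      by (auto simp: separating_index_sets_def)
  next
    fix H assume "H \<in> separating_hyperplanes (configuration p) (p $ i) (p $ j)"
    then obtain S where S: "S \<subseteq> configuration p - {p $ i, p $ j}" "card S = CARD('d)"
        "affine hull S = H" "separates H (p $ i) (p $ j)"
      by (auto simp: separating_hyperplanes_def)
    define J where "J = {k. p $ k \<in> S}"
    have S_eq: "S = (\<lambda>k. p $ k) ` J" using S(1) by (auto simp: J_def configuration_def)
    have "card J = CARD('d)"
      using S(2) inj unfolding S_eq by (simp add: card_image inj_on_subset)
    then have "J \<in> separating_index_sets p i j"
      using S unfolding separating_index_sets_def S_eq by (auto simp: J_def)
    then show "H \<in> ?h ` separating_index_sets p i j"
      using S(3) unfolding S_eq by blast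
  qed
  ultimately show ?thesis by (metis card_image)
qed

lemma range_mem_separating_index_sets_iff:
  fixes p :: "(real ^ 'd) ^ 'n" and \<sigma> :: "'d \<Rightarrow> 'n"
  assumes gen: "generic_configuration CARD('n) (configuration p)"
    and \<sigma>: "inj \<sigma>" "i \<notin> range \<sigma>" "j \<notin> range \<sigma>"
  shows "range \<sigma> \<in> separating_index_sets p i j \<longleftrightarrow> simplex_det p i \<sigma> * simplex_det p j \<sigma> < 0"
proof -
  have card: "card (range \<sigma>) = CARD('d)" using \<sigma>(1) by (simp add: card_image)
  have "inj (\<lambda>k. p $ \<sigma> k)"
    using generic_configuration_inj[OF gen] \<sigma>(1) by (simp add: inj_def)
  moreover have "\<not> affine_dependent (range (\<lambda>k. p $ \<sigma> k))"
    using generic_configuration_independent[OF gen, of "range \<sigma>"] card by (simp add: image_image)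
  ultimately show ?thesis
    using separates_affine_hull_iff_det[of "\<lambda>k. p $ \<sigma> k"] \<sigma> card
    by (simp add: separating_index_sets_def simplex_det_def image_image)
qed

section \<open>The effect of a flip\<close>

lemma continuous_on_simplex_det:
  fixes p :: "'a :: topological_space \<Rightarrow> (real ^ 'd) ^ 'n"
  assumes "continuous_on S p"
  shows "continuous_on S (\<lambda>t. simplex_det (p t) i \<sigma>)"
  unfolding simplex_det_def det_def by (auto intro!: continuous_intros assms)

lemma flip_generic:
  fixes P :: "real \<Rightarrow> (real ^ 'd) ^ 'n"
  assumes "flip P F"
  shows "generic_configuration CARD('n) (configuration (P (-1)))"
    and "generic_configuration CARD('n) (configuration (P 1))"
  using assms by (auto simp: flip_def)

lemma flip_simplex_det_sign:
  fixes P :: "real \<Rightarrow> (real ^ 'd) ^ 'n" and \<sigma> :: "'d \<Rightarrow> 'n"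
  assumes flip: "flip P F" and \<sigma>: "inj \<sigma>" "i \<notin> range \<sigma>"
  shows "insert i (range \<sigma>) = F \<Longrightarrow> simplex_det (P (-1)) i \<sigma> * simplex_det (P 1) i \<sigma> < 0"
    and "insert i (range \<sigma>) \<noteq> F \<Longrightarrow> simplex_det (P (-1)) i \<sigma> * simplex_det (P 1) i \<sigma> > 0"
proof -
  assume eq: "insert i (range \<sigma>) = F"
  from flip have "opposite_orientations (P (-1)) (P 1) F"
    by (simp add: flip_def)
  then obtain j \<tau> where \<tau>: "j \<in> F" "bij_betw \<tau> UNIV (F - {j})"
    and neg: "simplex_det (P (-1)) j \<tau> * simplex_det (P 1) j \<tau> < 0"
    unfolding opposite_orientations_def by blast
  have "range \<tau> = F - {j}" using \<tau>(2) by (rule bij_betw_imp_surj_on)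
  then obtain c where c: "\<And>f :: 'n \<Rightarrow> real ^ 'd. det (\<chi> k. f (\<sigma> k) - f i) = c * det (\<chi> k. f (\<tau> k) - f j)"
    using \<tau> eq by (elim det_change_of_base_vertex[of \<tau> j i \<sigma>, rotated -1]) (auto dest: bij_betw_imp_inj_on)
  have base: "simplex_det p i \<sigma> = c * simplex_det p j \<tau>" for p :: "(real ^ 'd) ^ 'n"
    unfolding simplex_det_def by (rule c)
  have "c \<noteq> 0"
    using generic_configuration_simplex_det[OF flip_generic(2)[OF flip] \<sigma>] base[of "P 1"] by auto
  have "simplex_det (P (-1)) i \<sigma> * simplex_det (P 1) i \<sigma> =
        c\<^sup>2 * (simplex_det (P (-1)) j \<tau> * simplex_det (P 1) j \<tau>)"
    by (simp add: base power2_eq_square)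
  also have "\<dots> < 0" using \<open>c \<noteq> 0\<close> neg by (metis mult_pos_neg zero_less_power2)
  finally show "simplex_det (P (-1)) i \<sigma> * simplex_det (P 1) i \<sigma> < 0" .
next
  assume neq: "insert i (range \<sigma>) \<noteq> F"
  have "card (insert i (range \<sigma>)) = CARD('d) + 1"
    using \<sigma> by (simp add: card_image)
  then have "\<not> affine_dependent_family (\<lambda>i. P 0 $ i) (insert i (range \<sigma>))"
    using flip neq unfolding flip_def by blast
  then have zero: "simplex_det (P 0) i \<sigma> \<noteq> 0"
    using simplex_det_nonzero_iff[OF \<sigma>] by blast
  have "simplex_det (P t) i \<sigma> \<noteq> 0" if "t \<in> {-1..1}" for t
  proof (cases "t = 0")
    case False
    then have "generic_configuration CARD('n) (configuration (P t))"
      using flip that unfolding flip_def by blast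
    then show ?thesis using \<sigma> by (rule generic_configuration_simplex_det)
  qed (use zero in simp)
  moreover have "continuous_on {-1..1} (\<lambda>t. simplex_det (P t) i \<sigma>)"
    using flip by (intro continuous_on_simplex_det) (simp add: flip_def)
  ultimately show "simplex_det (P (-1)) i \<sigma> * simplex_det (P 1) i \<sigma> > 0"
    by (intro continuous_on_same_sign[where S = "{-1..1}" and f = "\<lambda>t. simplex_det (P t) i \<sigma>"]) auto
qed

lemma same_sign_change_iff:
  fixes a a' b b' :: real
  assumes "a \<noteq> 0" "a' \<noteq> 0" "b \<noteq> 0" "b' \<noteq> 0"
  shows "(a * b < 0) = (a' * b' < 0) \<longleftrightarrow> (a * a' < 0) = (b * b' < 0)"
  using assms
  by (cases "a < 0"; cases "a' < 0"; cases "b < 0"; cases "b' < 0") (simp_all add: mult_less_0_iff)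

text \<open>
  Each of the two determinants whose signs are compared changes sign iff its simplex is the
  flipset.
\<close>

lemma flip_separating_index_sets:
  fixes P :: "real \<Rightarrow> (real ^ 'd) ^ 'n"
  assumes flip: "flip P F" and J: "i \<notin> J" "j \<notin> J" "card J = CARD('d)"
  shows "(J \<in> separating_index_sets (P (-1)) i j) = (J \<in> separating_index_sets (P 1) i j) \<longleftrightarrow>
         (insert i J = F) = (insert j J = F)"
proof -
  obtain \<sigma> :: "'d \<Rightarrow> 'n" where "bij_betw \<sigma> UNIV J"
    using J(3) finite_same_card_bij[of "UNIV :: 'd set" J] by auto
  then have \<sigma>: "inj \<sigma>" "J = range \<sigma>"
    by (auto simp: bij_betw_def)
  have sgn: "(simplex_det (P (-1)) m \<sigma> * simplex_det (P 1) m \<sigma> < 0) = (insert m J = F)"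
    "simplex_det (P (-1)) m \<sigma> \<noteq> 0" "simplex_det (P 1) m \<sigma> \<noteq> 0"
    if "m \<notin> J" for m
    using flip_simplex_det_sign[OF flip \<sigma>(1), of m] that \<sigma>(2)
    by (cases "insert m J = F"; force)+
  have "(J \<in> separating_index_sets p i j) = (simplex_det p i \<sigma> * simplex_det p j \<sigma> < 0)"
    if "generic_configuration CARD('n) (configuration p)" for p :: "(real ^ 'd) ^ 'n"
    using range_mem_separating_index_sets_iff[OF that \<sigma>(1), of i j] J(1,2) \<sigma>(2) by simp
  note sep = this[OF flip_generic(1)[OF flip]] this[OF flip_generic(2)[OF flip]]
  show ?thesis
    unfolding sep sgn(1)[OF J(1), symmetric] sgn(1)[OF J(2), symmetric]
    using sgn(2,3)[OF J(1)] sgn(2,3)[OF J(2)] by (rule same_sign_change_iff)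
qed

lemma flip_separating_index_sets_same_side:
  fixes P :: "real \<Rightarrow> (real ^ 'd) ^ 'n"
  assumes "flip P F" and "i \<noteq> j" and "i \<in> F \<longleftrightarrow> j \<in> F"
  shows "separating_index_sets (P (-1)) i j = separating_index_sets (P 1) i j"
proof -
  have "(J \<in> separating_index_sets (P (-1)) i j) = (J \<in> separating_index_sets (P 1) i j)" for J
  proof (cases "i \<notin> J \<and> j \<notin> J \<and> card J = CARD('d)")
    case True
    then have "insert i J \<noteq> F" "insert j J \<noteq> F" using assms(2,3) by auto
    then show ?thesis using flip_separating_index_sets[OF assms(1), of i J j] True by simp
  qed (auto simp: separating_index_sets_def)
  then show ?thesis by blast
qed

lemma flip_separating_index_sets_opposite_side:
  fixes P :: "real \<Rightarrow> (real ^ 'd) ^ 'n"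
  assumes flip: "flip P F" and "i \<in> F" and "j \<notin> F"
  shows "(J \<in> separating_index_sets (P (-1)) i j) = (J \<in> separating_index_sets (P 1) i j) \<longleftrightarrow>
           J \<noteq> F - {i}"
proof (cases "i \<notin> J \<and> j \<notin> J \<and> card J = CARD('d)")
  case True
  have "insert j J \<noteq> F" "insert i J = F \<longleftrightarrow> J = F - {i}" using assms(2,3) True by auto
  then show ?thesis using flip_separating_index_sets[OF flip, of i J j] True by auto
next
  case False
  have "card (F - {i}) = CARD('d)"
    using flip \<open>i \<in> F\<close> by (simp add: flip_def)
  then show ?thesis using False \<open>j \<notin> F\<close> by (auto simp: separating_index_sets_def)
qed

section \<open>The Orchard relation\<close>

lemma odd_card_toggle:
  assumes fin: "finite A" "finite B" and toggle: "\<And>x. (x \<in> A) = (x \<in> B) \<longleftrightarrow> x \<noteq> a"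
  shows "even (card A) \<longleftrightarrow> odd (card B)"
proof (cases "a \<in> B")
  case True
  then have "B = insert a A" "a \<notin> A" using toggle by blast+
  then show ?thesis using fin by simp
next
  case False
  then have "A = insert a B" using toggle by blast
  then show ?thesis using fin False by simp
qed

lemma orchard_iff:
  fixes p :: "(real ^ 'd) ^ 'n"
  assumes gen: "generic_configuration CARD('n) (configuration p)" and "i \<noteq> j"
  shows "(p $ i, p $ j) \<in> orchard (configuration p) \<longleftrightarrow>
         even (card (separating_index_sets p i j)) =
         even (int_binomial (int CARD('n) - 3) (CARD('d) - 1))"
proof -
  have "p $ i \<noteq> p $ j" using generic_configuration_inj[OF gen] \<open>i \<noteq> j\<close> by (auto dest: injD)
  moreover have "card (configuration p) = CARD('n)" using gen by (simp add: generic_configuration_def)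
  moreover have "[a = b] (mod 2) \<longleftrightarrow> even a = even b" for a b :: int
    using cong_def[of a b 2] by presburger
  ultimately show ?thesis
    unfolding orchard_def using card_separating_hyperplanes[OF gen, of i j]
    by (auto simp: configuration_def)
qed

theorem proposition1p3:
  fixes P :: "real \<Rightarrow> (real ^ 'd) ^ 'n" and F :: "'n set"
  assumes "flip P F"
  shows "(\<forall>i j. i \<noteq> j \<longrightarrow> (i \<in> F \<and> j \<in> F) \<or> (i \<notin> F \<and> j \<notin> F) \<longrightarrow>
            ((P (-1) $ i, P (-1) $ j) \<in> orchard (configuration (P (-1))) \<longleftrightarrow>
             (P 1 $ i, P 1 $ j) \<in> orchard (configuration (P 1)))) \<and>
         (\<forall>i j. i \<in> F \<longrightarrow> j \<notin> F \<longrightarrow>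
            ((P (-1) $ i, P (-1) $ j) \<in> orchard (configuration (P (-1))) \<longleftrightarrow>
             (P 1 $ i, P 1 $ j) \<notin> orchard (configuration (P 1))))"
proof (intro conjI allI impI)
  fix i j
  assume ij: "i \<noteq> j" "(i \<in> F \<and> j \<in> F) \<or> (i \<notin> F \<and> j \<notin> F)"
  then have "separating_index_sets (P (-1)) i j = separating_index_sets (P 1) i j"
    using flip_separating_index_sets_same_side[OF assms] by blast
  then show "(P (-1) $ i, P (-1) $ j) \<in> orchard (configuration (P (-1))) \<longleftrightarrow>
             (P 1 $ i, P 1 $ j) \<in> orchard (configuration (P 1))"
    using orchard_iff[OF flip_generic(1)[OF assms] ij(1)] orchard_iff[OF flip_generic(2)[OF assms] ij(1)]
    by simp
next
  fix i j
  assume ij: "i \<in> F" "j \<notin> F"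
  then have "i \<noteq> j" by blast
  have "even (card (separating_index_sets (P (-1)) i j)) \<longleftrightarrow>
        odd (card (separating_index_sets (P 1) i j))"
    using flip_separating_index_sets_opposite_side[OF assms ij] by (intro odd_card_toggle) auto
  then show "(P (-1) $ i, P (-1) $ j) \<in> orchard (configuration (P (-1))) \<longleftrightarrow>
             (P 1 $ i, P 1 $ j) \<notin> orchard (configuration (P 1))"
    using orchard_iff[OF flip_generic(1)[OF assms] \<open>i \<noteq> j\<close>] orchard_iff[OF flip_generic(2)[OF assms] \<open>i \<noteq> j\<close>]
    by auto
qed

end
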